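(* Let $p$ be a prime, $q=p^s$, $A=\mathbb{F}_q[t]$, $K=\mathbb{F}_q(t)$. Let $a,b\in\mathbb{Z}_+$ and let $m$ be the smallest nonnegative integer with $a+b\le p^m$. For $(x,y)\in\{(a,b),(b,a)\}$ define $H_{x,y}(t)=t^{-x}R_{x,y}(t)$, where $R_{x,y}(t)$ is the unique polynomial of degree $<x+y$ congruent modulo $t^{x+y}$ to $$-\left(t^{q-1}-1\right)^{p^m-x}\sum_{\theta\in\mathbb{F}_q^*}\left((t+\theta)^{q-1}-1\right)^x$$ (so $H_{x,y}$ is a polynomial of degree $<y$). Write $f(t)=H_{a,b}(t)=f_0+f_1t+\dots+f_{b-1}t^{b-1}$ and $g(t)=H_{b,a}(t)=g_0+g_1t+\dots+g_{a-1}t^{a-1}$. Then $$\Delta(a,b)=\sum_{i=0}^{b-1}f_iS_1(b-i)+\sum_{j=0}^{a-1}g_jS_1(a-j).$$ Equivalently, $$H_{a,b}(t)=\sum_{j=0}^{p^m-a}\sum_{k}\binom{p^m-a}{j}\binom{a}{k_1,\dots,k_{q-1}}(-1)^{a+j+1}\,t^{\,j(q-1)+\sigma(k)-a},$$ where the inner sum is over all $(q-1)$-tuples $k=(k_1,\dots,k_{q-1})$ of nonnegative integers with $k_1+\dots+k_{q-1}=a$ and $\sigma(k):=\sum_{i=1}^{q-1}i\,k_i$ divisible by $q-1$, and the pairs $(j,k)$ are restricted by $j(q-1)+\sigma(k)<a+b$; $H_{b,a}$ is given by the same formula with $a$ and $b$ interchanged.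
   Context: For $s\in\mathbb{Z}$, $S_1(s)=\sum_n n^{-s}\in K$, summed over all monic $n\in A$ of degree $1$. For $a,b\in\mathbb{Z}_+$, $\Delta(a,b)=S_1(a)S_1(b)-S_1(a+b)$. Integer coefficients (binomial and multinomial) are read in $\mathbb{F}_p$. *)

theory Defs
  imports
    "HOL-Computational_Algebra.Computational_Algebra"
    "HOL-Number_Theory.Cong"
    "HOL-Library.FuncSet"
    "HOL-Library.Cardinality"
begin

text \<open>The finite field \<open>F\<^sub>q\<close> is a type \<open>'a :: {finite, field}\<close> with \<open>q = CARD('a)\<close>; then
  \<open>A = 'a poly\<close>, \<open>K = 'a poly fract\<close>, and \<open>to_fract\<close> is the inclusion of \<open>A\<close> in \<open>K\<close>.\<close>

abbreviation var_t :: "'a::comm_semiring_1 poly" where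
  "var_t \<equiv> [:0, 1:]"

definition S1 :: "int \<Rightarrow> 'a::{finite, field} poly fract" where
  "S1 z = (\<Sum>n \<in> {n :: 'a poly. lead_coeff n = 1 \<and> degree n = 1}. to_fract n powi (- z))"

definition Delta :: "nat \<Rightarrow> nat \<Rightarrow> 'a::{finite, field} poly fract" where
  "Delta a b = S1 (int a) * S1 (int b) - S1 (int (a + b))"

definition R_rhs :: "nat \<Rightarrow> nat \<Rightarrow> nat \<Rightarrow> 'a::{finite, field} poly" where
  "R_rhs p m x =
     - ((var_t ^ (CARD('a) - 1) - 1) ^ (p ^ m - x) *
        (\<Sum>\<theta> \<in> UNIV - {0 :: 'a}. ((var_t + [:\<theta>:]) ^ (CARD('a) - 1) - 1) ^ x))"

definition R_poly :: "nat \<Rightarrow> nat \<Rightarrow> nat \<Rightarrow> nat \<Rightarrow> 'a::{finite, field} poly" where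
  "R_poly p m x y =
     (THE R. degree R < x + y \<and> [R = R_rhs p m x] (mod var_t ^ (x + y)))"

text \<open>Well-definedness of \<open>R_poly\<close>.\<close>

lemma ex1_R_poly:
  fixes F :: "'a::field poly"
  assumes "n > 0"
  shows "\<exists>!R. degree R < n \<and> [R = F] (mod var_t ^ n)"
proof -
  have deg: "degree (var_t ^ n :: 'a poly) = n"
    by (simp add: degree_power_eq)
  have nz: "(var_t ^ n :: 'a poly) \<noteq> 0"
    by simp
  have red: "R mod var_t ^ n = R" if "degree R < n" for R :: "'a poly"
    using that deg by (simp add: mod_poly_less)
  have "degree (F mod var_t ^ n) < n"
    using degree_mod_less[OF nz, of F] deg assms by auto
  moreover have "[F mod var_t ^ n = F] (mod var_t ^ n)"
    by (simp add: cong_def)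
  moreover have "R = F mod var_t ^ n" if "degree R < n" "[R = F] (mod var_t ^ n)" for R
    using that red[of R] by (simp add: cong_def)
  ultimately show ?thesis
    by blast
qed

text \<open>\<open>H\<close> lives in \<open>K\<close>, because \<open>t\<^sup>-\<^sup>x\<close> does; that it is a polynomial is something to prove.\<close>

definition H_frac :: "nat \<Rightarrow> nat \<Rightarrow> nat \<Rightarrow> nat \<Rightarrow> 'a::{finite, field} poly fract" where
  "H_frac p m x y = to_fract var_t powi (- int x) * to_fract (R_poly p m x y)"

text \<open>The division is exact when \<open>n\<close> is the sum of \<open>k\<close> over \<open>I\<close>, which is the only case used.\<close>

definition multinomial :: "nat \<Rightarrow> 'i set \<Rightarrow> ('i \<Rightarrow> nat) \<Rightarrow> nat" where
  "multinomial n I k = fact n div (\<Prod>i\<in>I. fact (k i))"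

definition sigma_tuple :: "nat \<Rightarrow> (nat \<Rightarrow> nat) \<Rightarrow> nat" where
  "sigma_tuple r k = (\<Sum>i = 1..r. i * k i)"

text \<open>Tuples \<open>(k\<^sub>1, \<dots>, k\<^sub>r)\<close> are extensional functions on \<open>{1..r}\<close>.\<close>

definition adm_tuples :: "nat \<Rightarrow> nat \<Rightarrow> (nat \<Rightarrow> nat) set" where
  "adm_tuples r x =
     {k \<in> {1..r} \<rightarrow>\<^sub>E UNIV. (\<Sum>i = 1..r. k i) = x \<and> r dvd sigma_tuple r k}"

lemma finite_adm_tuples: "finite (adm_tuples r x)"
proof (rule finite_subset)
  show "adm_tuples r x \<subseteq> {1..r} \<rightarrow>\<^sub>E {..x}"
  proof
    fix k assume k: "k \<in> adm_tuples r x"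
    have "k i \<le> x" if "i \<in> {1..r}" for i
      using k member_le_sum[OF that, of k] by (auto simp: adm_tuples_def)
    then show "k \<in> {1..r} \<rightarrow>\<^sub>E {..x}"
      using k by (auto simp: adm_tuples_def PiE_iff)
  qed
qed (simp add: finite_PiE)

end

theory Submission
  imports Defs
begin

text \<open>Apart from the diagonal terms, which add up to \<open>S\<^sub>1(a+b)\<close>, the product \<open>S\<^sub>1(a) S\<^sub>1(b)\<close> is the sum of
  \<open>X\<^sup>-\<^sup>b (X+\<theta>)\<^sup>-\<^sup>a\<close> over \<open>\<theta> \<noteq> 0\<close> and over the translates \<open>X\<close> of \<open>t\<close>. In the partial fraction
  decomposition the numerator over \<open>X\<^sup>b\<close> is \<open>(X+\<theta>)\<^sup>-\<^sup>a\<close> modulo \<open>X\<^sup>b\<close>, and, after a translation, the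
  numerator over \<open>(X+\<theta>)\<^sup>a\<close> is \<open>(X-\<theta>)\<^sup>-\<^sup>b\<close> modulo \<open>X\<^sup>a\<close>. Hence \<open>f\<close> and \<open>g\<close> are the sums over \<open>\<theta>\<close> of these
  truncated inverses. They are \<open>H\<^bsub>a,b\<^esub>\<close> and \<open>H\<^bsub>b,a\<^esub>\<close> because \<open>(t+\<theta>) ((t+\<theta>)\<^bsup>q-1\<^esup> - 1) = t (t\<^bsup>q-1\<^esup> - 1)\<close> and
  \<open>-(t\<^bsup>q-1\<^esup> - 1)\<^bsup>p^m\<^esup> = 1 - t\<^bsup>(q-1)p^m\<^esup>\<close> is \<open>1\<close> modulo \<open>t\<^bsup>a+b\<^esup>\<close>.

  For the explicit formula, \<open>(t+\<theta>)\<^bsup>q-1\<^esup> - 1\<close> is the sum of \<open>(-t/\<theta>)\<^sup>i\<close> over \<open>1 \<le> i \<le> q-1\<close>; after expanding its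
  \<open>x\<close>-th power, the sum over \<open>\<theta>\<close> keeps exactly the exponents \<open>\<sigma>(k)\<close> divisible by \<open>q-1\<close>.\<close>

section \<open>Multinomial coefficients and the multinomial theorem\<close>

lemma prod_fact_dvd_fact_sum:
  "finite I \<Longrightarrow> (\<Prod>i\<in>I. fact (k i)) dvd (fact (\<Sum>i\<in>I. k i) :: nat)"
proof (induction I rule: finite_induct)
  case (insert i I)
  have "(\<Prod>j\<in>insert i I. fact (k j)) dvd fact (k i) * (fact (\<Sum>j\<in>I. k j) :: nat)"
    using insert by (simp add: mult_dvd_mono)
  also have "\<dots> dvd fact (k i + (\<Sum>j\<in>I. k j))"
    by (rule fact_fact_dvd_fact)
  finally show ?case using insert by simp
qed simp

text \<open>Peels off one index, as the induction below requires. The product of the factorials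
  divides the factorial of the sum, so \<open>div\<close> is exact and the binomial factor passes
  through it.\<close>

lemma multinomial_insert:
  assumes "finite I" "i \<notin> I"
  shows "multinomial (j + (\<Sum>l\<in>I. k l)) (insert i I) (k(i := j)) =
    (j + (\<Sum>l\<in>I. k l) choose j) * multinomial (\<Sum>l\<in>I. k l) I k"
proof -
  let ?n = "\<Sum>l\<in>I. k l" and ?P = "\<Prod>l\<in>I. fact (k l) :: nat"
  have P: "(\<Prod>l\<in>insert i I. fact ((k(i := j)) l)) = fact j * ?P"
  proof -
    have "(\<Prod>l\<in>I. fact ((k(i := j)) l)) = ?P"
      using assms by (intro prod.cong) auto
    then show ?thesis using assms by simp
  qed
  have "fact (j + ?n) = fact j * ((j + ?n choose j) * fact ?n)"
    using binomial_fact_lemma[of j "j + ?n"] by (simp add: mult_ac)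
  then have "multinomial (j + ?n) (insert i I) (k(i := j)) = (j + ?n choose j) * fact ?n div ?P"
    unfolding multinomial_def P by simp
  then show ?thesis
    using prod_fact_dvd_fact_sum[OF assms(1), of k] by (simp add: multinomial_def div_mult_swap)
qed

lemma finite_PiE_sum_eq:
  assumes "finite I"
  shows "finite {k \<in> I \<rightarrow>\<^sub>E (UNIV :: nat set). (\<Sum>i\<in>I. k i) = n}"
proof (rule finite_subset)
  show "{k \<in> I \<rightarrow>\<^sub>E UNIV. (\<Sum>i\<in>I. k i) = n} \<subseteq> I \<rightarrow>\<^sub>E {..n}"
  proof
    fix k assume k: "k \<in> {k \<in> I \<rightarrow>\<^sub>E (UNIV :: nat set). (\<Sum>i\<in>I. k i) = n}"
    have "k i \<le> n" if "i \<in> I" for i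
      using k member_le_sum[OF that, of k] assms by auto
    then show "k \<in> I \<rightarrow>\<^sub>E {..n}"
      using k by (auto simp: PiE_iff)
  qed
qed (simp add: finite_PiE assms)

text \<open>Induction on the index set: the binomial theorem splits off \<open>f i\<close>, and a
  tuple on \<open>insert i I\<close> amounts to its value \<open>j\<close> at \<open>i\<close> and a
  tuple on \<open>I\<close> of sum \<open>n - j\<close>.\<close>

lemma multinomial_theorem:
  fixes f :: "'i \<Rightarrow> 'a::comm_semiring_1"
  assumes "finite I"
  shows "(\<Sum>i\<in>I. f i) ^ n =
    (\<Sum>k\<in>{k \<in> I \<rightarrow>\<^sub>E UNIV. (\<Sum>i\<in>I. k i) = n}. of_nat (multinomial n I k) * (\<Prod>i\<in>I. f i ^ k i))"
  using assms
proof (induction I arbitrary: n rule: finite_induct)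
  case empty
  have "{k \<in> {} \<rightarrow>\<^sub>E (UNIV :: nat set). (\<Sum>i\<in>{}. k i) = n} = (if n = 0 then {\<lambda>i::'i. undefined} else {})"
    by auto
  then show ?case by (simp add: multinomial_def zero_power)
next
  case (insert i I)
  let ?T = "\<lambda>I n. {k \<in> I \<rightarrow>\<^sub>E (UNIV :: nat set). (\<Sum>l\<in>I. k l) = n}"
  have fin: "finite (?T I n)" for n
    using insert.hyps(1) by (rule finite_PiE_sum_eq)
  have "(\<Sum>l\<in>insert i I. f l) ^ n = (f i + (\<Sum>l\<in>I. f l)) ^ n"
    using insert.hyps by simp
  also have "\<dots> = (\<Sum>j\<le>n. of_nat (n choose j) * f i ^ j *
      (\<Sum>k\<in>?T I (n - j). of_nat (multinomial (n - j) I k) * (\<Prod>l\<in>I. f l ^ k l)))"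
    by (simp add: binomial_ring insert.IH)
  also have "\<dots> = (\<Sum>(j, k)\<in>(SIGMA j:{..n}. ?T I (n - j)). of_nat (n choose j) * f i ^ j *
      (of_nat (multinomial (n - j) I k) * (\<Prod>l\<in>I. f l ^ k l)))"
    unfolding sum_distrib_left by (rule sum.Sigma) (use fin in auto)
  \<comment> \<open>Resetting the value at \<open>i\<close> to \<open>undefined\<close> makes the
    restricted tuple extensional on \<open>I\<close>, so the two maps are mutually inverse.\<close>
  also have "\<dots> = (\<Sum>k\<in>?T (insert i I) n. of_nat (multinomial n (insert i I) k) *
      (\<Prod>l\<in>insert i I. f l ^ k l))"
  proof (rule sum.reindex_bij_witness[of _ "\<lambda>k. (k i, k(i := undefined))" "\<lambda>(j, k). k(i := j)"],
      goal_cases)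
    case (1 x)
    then show ?case using insert.hyps by (auto simp: PiE_iff extensional_def)
  next
    case (2 x)
    obtain j k where x: "x = (j, k)" by force
    have "(\<Sum>l\<in>I. (k(i := j)) l) = (\<Sum>l\<in>I. k l)"
      using insert.hyps by (intro sum.cong) auto
    then show ?case using 2 insert.hyps by (auto simp: x PiE_iff extensional_def)
  next
    case (3 k)
    then show ?case by auto
  next
    case (4 k)
    have "(\<Sum>l\<in>I. (k(i := undefined)) l) = (\<Sum>l\<in>I. k l)"
      using insert.hyps by (intro sum.cong) auto
    then show ?case using 4 insert.hyps by (auto simp: PiE_iff extensional_def)
  next
    case (5 x)
    obtain j k where x: "x = (j, k)" by force
    have n: "n = j + (\<Sum>l\<in>I. k l)" using 5 by (auto simp: x)
    have "(\<Prod>l\<in>I. f l ^ (k(i := j)) l) = (\<Prod>l\<in>I. f l ^ k l)"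
      using insert.hyps by (intro prod.cong) auto
    then show ?case
      using insert.hyps multinomial_insert[of I i j k] by (simp add: x n mult_ac)
  qed
  finally show ?case .
qed

section \<open>Finite fields and prime characteristic\<close>

text \<open>Translation by 1 permutes the ring, so \<open>x + 1\<close> and \<open>x\<close> have
  the same sum over it.\<close>

lemma of_nat_CARD_eq_0: "of_nat CARD('a::{finite, ring_1}) = (0 :: 'a)"
proof -
  have "(\<Sum>x\<in>UNIV. x + 1) = (\<Sum>x\<in>UNIV. x :: 'a)"
    by (rule sum.reindex_bij_witness[of _ "\<lambda>x. x - 1" "\<lambda>x. x + 1"]) auto
  then show ?thesis by (simp add: sum.distrib)
qed

text \<open>Multiplication by \<open>x\<close> permutes the nonzero elements, and their nonzero
  product cancels.\<close>

lemma power_CARD_minus_1: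
  fixes x :: "'a::{finite, field}"
  assumes "x \<noteq> 0"
  shows "x ^ (CARD('a) - 1) = 1"
proof -
  have "(\<Prod>y\<in>UNIV-{0}. x * y) = (\<Prod>y\<in>UNIV-{0}. y)"
    by (rule prod.reindex_bij_witness[of _ "\<lambda>y. y / x" "\<lambda>y. x * y"]) (use assms in auto)
  then have "x ^ (CARD('a) - 1) * \<Prod>(UNIV-{0}) = \<Prod>(UNIV-{0::'a})"
    by (simp add: prod.distrib)
  then show ?thesis by simp
qed

lemma CARD_field_ge_2: "CARD('a::{finite, field}) \<ge> 2"
proof -
  have "card {0, 1 :: 'a} \<le> CARD('a)" by (rule card_mono) auto
  then show ?thesis by simp
qed

lemma power_CARD:
  fixes x :: "'a::{finite, field}"
  shows "x ^ CARD('a) = x"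
proof (cases "x = 0")
  case False
  have "x ^ CARD('a) = x * x ^ (CARD('a) - 1)"
    using CARD_field_ge_2[where ?'a = 'a] by (subst power_Suc[symmetric]) simp
  then show ?thesis using power_CARD_minus_1[OF False] by simp
qed (simp add: zero_power)

text \<open>If q-1 divides n, every term is 1 and q-1 = -1 in the field. Otherwise some nonzero g
  has g^n different from 1; multiplication by g permutes the range and scales the sum by g^n, so the
  sum vanishes.\<close>

lemma sum_power_nonzero:
  "(\<Sum>\<theta>\<in>UNIV - {0 :: 'a::{finite, field}}. \<theta> ^ n) = (if CARD('a) - 1 dvd n then - 1 else 0)"
proof (cases "CARD('a) - 1 dvd n")
  case True
  then obtain d where n: "n = (CARD('a) - 1) * d" ..
  have "(\<Sum>\<theta>\<in>UNIV - {0 :: 'a}. \<theta> ^ n) = (\<Sum>\<theta>\<in>UNIV - {0 :: 'a}. 1)"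
    by (intro sum.cong) (auto simp: n power_mult power_CARD_minus_1 simp del: One_nat_def)
  also have "\<dots> = of_nat (CARD('a) - 1)" by simp
  also have "\<dots> = - 1"
    using CARD_field_ge_2[where ?'a = 'a] by (simp add: of_nat_diff of_nat_CARD_eq_0)
  finally show ?thesis using True by simp
next
  case False
  define r where "r = n mod (CARD('a) - 1)"
  have r: "0 < r" "r < CARD('a) - 1"
    using False CARD_field_ge_2[where ?'a = 'a] by (auto simp: r_def mod_greater_zero_iff_not_dvd)
  have pow: "\<theta> ^ n = \<theta> ^ r" if "\<theta> \<noteq> 0" for \<theta> :: 'a
  proof -
    have "\<theta> ^ n = \<theta> ^ ((CARD('a) - 1) * (n div (CARD('a) - 1)) + r)"
      unfolding r_def by simp
    then show ?thesis
      using power_CARD_minus_1[OF that] by (simp only: power_add power_mult power_one mult_1)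
  qed
  \<comment> \<open>Since 0 < \<open>r\<close> < q-1, this polynomial is nonzero and has at most
    \<open>r\<close> roots, too few to cover the q-1 nonzero elements.\<close>
  let ?P = "monom 1 r - 1 :: 'a poly"
  have "coeff ?P r = 1" using r by (simp add: coeff_1)
  then have "?P \<noteq> 0" by (metis coeff_0 zero_neq_one)
  then have "card {x. poly ?P x = 0} \<le> degree ?P" by (rule card_poly_roots_bound)
  also have "\<dots> \<le> r" by (intro degree_diff_le) (auto simp: degree_monom_le)
  finally have "card {x. poly ?P x = 0} < card (UNIV - {0 :: 'a})"
    using r by (simp add: card_Diff_subset)
  then have "\<not> UNIV - {0} \<subseteq> {x. poly ?P x = 0}"
    by (meson card_mono finite leD)
  then obtain g :: 'a where g: "g \<noteq> 0" "g ^ n \<noteq> 1"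
    using pow by (auto simp: poly_monom)
  have "(\<Sum>\<theta>\<in>UNIV - {0 :: 'a}. \<theta> ^ n) = (\<Sum>\<theta>\<in>UNIV - {0}. (g * \<theta>) ^ n)"
    by (rule sum.reindex_bij_witness[of _ "\<lambda>y. g * y" "\<lambda>y. y / g"]) (use g in auto)
  also have "\<dots> = g ^ n * (\<Sum>\<theta>\<in>UNIV - {0}. \<theta> ^ n)"
    by (simp add: power_mult_distrib sum_distrib_left)
  finally show ?thesis using g False by simp
qed

text \<open>Expanding a power of 1 + (-1) = 0 by the Frobenius map treats even and odd
  characteristic alike.\<close>

lemma minus_one_power_prime_char_power:
  assumes "prime CHAR('a::comm_ring_1)"
  shows "(- 1 :: 'a) ^ (CHAR('a) ^ n) = - 1"
proof -
  have "(0::'a) = (1 + (- 1)) ^ (CHAR('a) ^ n)"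
    using prime_gt_0_nat[OF assms] by (simp add: zero_power)
  also have "\<dots> = 1 + (- 1) ^ (CHAR('a) ^ n)"
    using freshmans_dream'[OF assms, of "CHAR('a) ^ n" n 1 "- 1"] by simp
  finally show ?thesis by (simp add: eq_neg_iff_add_eq_0 add.commute)
qed

lemma pcompose_power: "(p ^ n) \<circ>\<^sub>p (r :: 'a::comm_ring_1 poly) = (p \<circ>\<^sub>p r) ^ n"
  by (induction n) (simp_all add: pcompose_mult pcompose_1)

section \<open>Partial fractions with two poles\<close>

text \<open>The defect \<open>D\<close> of the identity is divisible by t^b and by (t+\<theta>)^a,
  which are coprime as \<theta> \<noteq> 0. Its degree is below a+b, so it vanishes.\<close>

lemma partial_fractions:
  fixes F G :: "'a::field poly"
  assumes "\<theta> \<noteq> 0" "degree F < b" "degree G < a"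
    and F: "[F * [:\<theta>, 1:] ^ a = 1] (mod var_t ^ b)"
    and G: "[G * [:- \<theta>, 1:] ^ b = 1] (mod var_t ^ a)"
  shows "F * [:\<theta>, 1:] ^ a + (G \<circ>\<^sub>p [:\<theta>, 1:]) * var_t ^ b = 1"
proof (rule ccontr)
  define D where "D = F * [:\<theta>, 1:] ^ a + (G \<circ>\<^sub>p [:\<theta>, 1:]) * var_t ^ b - 1"
  assume "\<not> ?thesis"
  then have D: "D \<noteq> 0" by (simp add: D_def)
  have "var_t ^ b dvd F * [:\<theta>, 1:] ^ a - 1"
    using F by (simp add: cong_iff_dvd_diff)
  then have "var_t ^ b dvd D"
    unfolding D_def by (metis add_diff_eq add.commute dvd_add dvd_triv_right)
  then obtain E where E: "D = var_t ^ b * E" ..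
  have "var_t ^ a dvd G * [:- \<theta>, 1:] ^ b - 1"
    using G by (simp add: cong_iff_dvd_diff)
  then obtain L where "G * [:- \<theta>, 1:] ^ b - 1 = var_t ^ a * L" ..
  \<comment> \<open>Substituting t+\<theta> for t moves the congruence for \<open>G\<close> from the
    point 0 to -\<theta>: t-\<theta> becomes t, and the modulus becomes (t+\<theta>)^a.\<close>
  then have "(G * [:- \<theta>, 1:] ^ b - 1) \<circ>\<^sub>p [:\<theta>, 1:] = (var_t ^ a * L) \<circ>\<^sub>p [:\<theta>, 1:]"
    by simp
  then have "(G \<circ>\<^sub>p [:\<theta>, 1:]) * var_t ^ b - 1 = [:\<theta>, 1:] ^ a * (L \<circ>\<^sub>p [:\<theta>, 1:])"
    by (simp add: pcompose_mult pcompose_diff pcompose_power pcompose_pCons pcompose_1)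
  then have "D = [:\<theta>, 1:] ^ a * (F + L \<circ>\<^sub>p [:\<theta>, 1:])"
    by (simp add: D_def algebra_simps)
  \<comment> \<open>Coprimality enters through the multiplicity of the root -\<theta>: t^b does not
    vanish there, so \<open>E\<close> carries all of it. The double minus is the form that
    \<open>order_divides\<close> expects.\<close>
  then have "[:- (- \<theta>), 1:] ^ a dvd D" by simp
  then have "a \<le> order (- \<theta>) D" using D by (simp only: order_divides) simp
  also have "\<dots> = order (- \<theta>) (var_t ^ b) + order (- \<theta>) E"
    using D by (simp add: E order_mult)
  also have "order (- \<theta>) (var_t ^ b) = 0"
    using assms(1) by (intro order_0I) simp
  also have "0 + order (- \<theta>) E \<le> degree E"
    using D E by (simp add: order_degree)
  finally have "a \<le> degree E" .
  then have "a + b \<le> degree D"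
    using D by (simp add: E degree_mult_eq degree_power_eq)
  moreover have "degree D < a + b"
  proof -
    have "degree (F * [:\<theta>, 1:] ^ a) \<le> degree F + a"
      using degree_mult_le[of F "[:\<theta>, 1:] ^ a"] by (simp add: degree_power_eq)
    moreover have "degree ((G \<circ>\<^sub>p [:\<theta>, 1:]) * var_t ^ b) \<le> degree G + b"
      using degree_mult_le[of "G \<circ>\<^sub>p [:\<theta>, 1:]" "var_t ^ b"]
      by (simp add: degree_power_eq degree_pcompose)
    ultimately show ?thesis
      unfolding D_def using assms(2,3)
      by (intro degree_diff_less degree_add_less) auto
  qed
  ultimately show False by simp
qed

section \<open>Delta as a sum over translates of t\<close>

text \<open>A monic polynomial of degree 1 is determined by its constant coefficient, so the field
  itself can serve as index set.\<close>

lemma S1_eq_sum: "S1 z = (\<Sum>\<eta>\<in>(UNIV :: 'a::{finite, field} set). to_fract [:\<eta>, 1:] powi (- z))"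
proof -
  have "n \<in> range (\<lambda>\<eta>. [:\<eta>, 1:])" if "lead_coeff n = 1" "degree n = 1" for n :: "'a poly"
  proof -
    have "n = [:coeff n 0, 1:]"
      using that by (intro poly_eqI) (auto simp: coeff_pCons coeff_eq_0 split: nat.splits)
    then show ?thesis by blast
  qed
  then have "{n :: 'a poly. lead_coeff n = 1 \<and> degree n = 1} = range (\<lambda>\<eta>. [:\<eta>, 1:])"
    by auto
  then show ?thesis
    by (simp add: S1_def sum.reindex inj_on_def)
qed

lemma to_fract_power: "to_fract (x ^ n) = to_fract x ^ n"
  by (induction n) simp_all

lemma to_fract_pcompose:
  fixes f :: "'a::field poly"
  assumes "degree f < n"
  shows "to_fract (f \<circ>\<^sub>p g) = (\<Sum>i<n. to_fract [:coeff f i:] * to_fract g ^ i)"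
proof -
  have "f \<circ>\<^sub>p g = (\<Sum>i\<le>degree f. [:coeff f i:] * g ^ i)"
    by (simp add: pcompose_altdef poly_altdef degree_map_poly coeff_map_poly)
  also have "\<dots> = (\<Sum>i<n. [:coeff f i:] * g ^ i)"
    using assms by (intro sum.mono_neutral_left) (auto simp: coeff_eq_0)
  finally show ?thesis by (simp only: to_fract_sum to_fract_mult to_fract_power)
qed

text \<open>With X = t+\<eta>, dividing f(X) by X^n leaves the powers X^(i-n); summing each of them
  over \<eta> gives the value of \<open>S1\<close> at n-i.\<close>

lemma sum_pcompose_div_power:
  fixes f :: "'a::{finite, field} poly"
  assumes "degree f < n"
  shows "(\<Sum>\<eta>\<in>UNIV. to_fract (f \<circ>\<^sub>p [:\<eta>, 1:]) / to_fract [:\<eta>, 1:] ^ n) =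
    (\<Sum>i<n. to_fract [:coeff f i:] * S1 (int n - int i))"
proof -
  have "to_fract [:\<eta>, 1:] powi - (int n - int i) = to_fract [:\<eta>, 1:] ^ i / to_fract [:\<eta>, 1:] ^ n"
    for \<eta> :: 'a and i
    using power_int_diff[of "to_fract [:\<eta>, 1:]" "int i" "int n"] by simp
  then have "(\<Sum>i<n. to_fract [:coeff f i:] * S1 (int n - int i)) =
      (\<Sum>i<n. \<Sum>\<eta>\<in>UNIV. to_fract [:coeff f i:] * (to_fract [:\<eta>, 1:] ^ i / to_fract [:\<eta>, 1:] ^ n))"
    by (simp only: S1_eq_sum sum_distrib_left)
  also have "\<dots> = (\<Sum>\<eta>\<in>UNIV. \<Sum>i<n. to_fract [:coeff f i:] * (to_fract [:\<eta>, 1:] ^ i / to_fract [:\<eta>, 1:] ^ n))"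
    by (rule sum.swap)
  also have "\<dots> = (\<Sum>\<eta>\<in>UNIV. to_fract (f \<circ>\<^sub>p [:\<eta>, 1:]) / to_fract [:\<eta>, 1:] ^ n)"
    by (simp add: to_fract_pcompose[OF assms] sum_divide_distrib)
  finally show ?thesis ..
qed

lemma Delta_eq_sum:
  "(Delta a b :: 'a::{finite, field} poly fract) =
    (\<Sum>\<theta>\<in>UNIV - {0 :: 'a}. \<Sum>\<eta>\<in>UNIV. 1 / (to_fract [:\<eta>, 1:] ^ b * to_fract [:\<eta> + \<theta>, 1:] ^ a))"
proof -
  define h where "h \<theta> \<eta> = 1 / (to_fract [:\<eta>, 1:] ^ b * to_fract [:\<eta> + \<theta>, 1:] ^ a)" for \<theta> \<eta> :: 'a
  have powi: "to_fract [:\<eta>, 1:] powi - int n = 1 / to_fract [:\<eta>, 1:] ^ n" for n and \<eta> :: 'a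
    by (simp add: power_int_minus_divide)
  have "S1 (int a) * S1 (int b) =
      (\<Sum>\<eta>\<in>(UNIV :: 'a set). \<Sum>\<zeta>\<in>(UNIV :: 'a set). 1 / (to_fract [:\<eta>, 1:] ^ b * to_fract [:\<zeta>, 1:] ^ a))"
    unfolding S1_eq_sum powi by (subst mult.commute) (simp add: sum_product)
  also have "\<dots> = (\<Sum>\<eta>\<in>(UNIV :: 'a set). \<Sum>\<theta>\<in>(UNIV :: 'a set). h \<theta> \<eta>)"
  proof (rule sum.cong[OF refl])
    fix \<eta> :: 'a
    show "(\<Sum>\<zeta>\<in>UNIV. 1 / (to_fract [:\<eta>, 1:] ^ b * to_fract [:\<zeta>, 1:] ^ a)) = (\<Sum>\<theta>\<in>UNIV. h \<theta> \<eta>)"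
      unfolding h_def
      by (rule sum.reindex_bij_witness[of _ "\<lambda>\<theta>. \<eta> + \<theta>" "\<lambda>\<zeta>. \<zeta> - \<eta>"]) auto
  qed
  also have "\<dots> = (\<Sum>\<theta>\<in>UNIV. \<Sum>\<eta>\<in>UNIV. h \<theta> \<eta>)" by (rule sum.swap)
  also have "\<dots> = (\<Sum>\<eta>\<in>UNIV. h 0 \<eta>) + (\<Sum>\<theta>\<in>UNIV - {0}. \<Sum>\<eta>\<in>UNIV. h \<theta> \<eta>)"
    by (subst sum.remove[of _ 0]) auto
  also have "(\<Sum>\<eta>\<in>UNIV. h 0 \<eta>) = S1 (int (a + b))"
    unfolding S1_eq_sum powi by (simp add: h_def power_add mult.commute)
  finally show ?thesis by (simp add: Delta_def h_def)
qed

text \<open>Both families invert powers of t+\<theta>, so the statement is symmetric in a and b. The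
  opposite sign in the second numerator disappears because \<theta> and -\<theta> run over the same
  set.\<close>

lemma Delta_partial_fractions:
  fixes F G :: "'a::{finite, field} \<Rightarrow> 'a poly"
  assumes deg: "\<And>\<theta>. degree (F \<theta>) < b" "\<And>\<theta>. degree (G \<theta>) < a"
    and F: "\<And>\<theta>. \<theta> \<noteq> 0 \<Longrightarrow> [F \<theta> * [:\<theta>, 1:] ^ a = 1] (mod var_t ^ b)"
    and G: "\<And>\<theta>. \<theta> \<noteq> 0 \<Longrightarrow> [G \<theta> * [:\<theta>, 1:] ^ b = 1] (mod var_t ^ a)"
  defines "f \<equiv> \<Sum>\<theta>\<in>UNIV - {0}. F \<theta>" and "g \<equiv> \<Sum>\<theta>\<in>UNIV - {0}. G \<theta>"
  shows "Delta a b = (\<Sum>i<b. to_fract [:coeff f i:] * S1 (int b - int i)) +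
    (\<Sum>j<a. to_fract [:coeff g j:] * S1 (int a - int j))"
proof -
  let ?X = "\<lambda>\<eta>::'a. to_fract [:\<eta>, 1:]"
  have nz: "?X \<eta> \<noteq> 0" for \<eta> by simp
  have shift: "[:\<theta>, 1:] \<circ>\<^sub>p [:\<eta>, 1:] = [:\<eta> + \<theta>, 1:]" for \<theta> \<eta> :: 'a
    by (simp add: pcompose_pCons add.commute)
  have split: "1 / (?X \<eta> ^ b * ?X (\<eta> + \<theta>) ^ a) =
      to_fract (F \<theta> \<circ>\<^sub>p [:\<eta>, 1:]) / ?X \<eta> ^ b +
      to_fract (G (- \<theta>) \<circ>\<^sub>p [:\<eta> + \<theta>, 1:]) / ?X (\<eta> + \<theta>) ^ a" if "\<theta> \<noteq> 0" for \<theta> \<eta>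
  proof -
    \<comment> \<open>The second numerator has to invert (t-\<theta>)^b, hence \<open>G\<close> at
      -\<theta>.\<close>
    have "F \<theta> * [:\<theta>, 1:] ^ a + (G (- \<theta>) \<circ>\<^sub>p [:\<theta>, 1:]) * var_t ^ b = 1"
      using that deg F[of \<theta>] G[of "- \<theta>"] by (intro partial_fractions) auto
    then have "(F \<theta> * [:\<theta>, 1:] ^ a + (G (- \<theta>) \<circ>\<^sub>p [:\<theta>, 1:]) * var_t ^ b) \<circ>\<^sub>p [:\<eta>, 1:] = 1"
      by (simp add: pcompose_1)
    then have "(F \<theta> \<circ>\<^sub>p [:\<eta>, 1:]) * [:\<eta> + \<theta>, 1:] ^ a +
        (G (- \<theta>) \<circ>\<^sub>p [:\<eta> + \<theta>, 1:]) * [:\<eta>, 1:] ^ b = 1"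
      by (simp add: pcompose_mult pcompose_add pcompose_power shift flip: pcompose_assoc)
    then have "to_fract (F \<theta> \<circ>\<^sub>p [:\<eta>, 1:]) * ?X (\<eta> + \<theta>) ^ a +
        to_fract (G (- \<theta>) \<circ>\<^sub>p [:\<eta> + \<theta>, 1:]) * ?X \<eta> ^ b = 1"
      by (metis to_fract_1 to_fract_add to_fract_mult to_fract_power)
    then show ?thesis
      using nz[of \<eta>] nz[of "\<eta> + \<theta>"] by (simp add: divide_simps mult_ac)
  qed
  have "(Delta a b :: 'a poly fract) = (\<Sum>\<theta>\<in>UNIV - {0}. \<Sum>\<eta>\<in>UNIV. to_fract (F \<theta> \<circ>\<^sub>p [:\<eta>, 1:]) / ?X \<eta> ^ b) +
      (\<Sum>\<theta>\<in>UNIV - {0}. \<Sum>\<eta>\<in>UNIV. to_fract (G (- \<theta>) \<circ>\<^sub>p [:\<eta> + \<theta>, 1:]) / ?X (\<eta> + \<theta>) ^ a)"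
    by (simp add: Delta_eq_sum split flip: sum.distrib)
  also have "(\<Sum>\<theta>\<in>UNIV - {0}. \<Sum>\<eta>\<in>UNIV. to_fract (F \<theta> \<circ>\<^sub>p [:\<eta>, 1:]) / ?X \<eta> ^ b) =
      (\<Sum>\<eta>\<in>UNIV. to_fract (f \<circ>\<^sub>p [:\<eta>, 1:]) / ?X \<eta> ^ b)"
    by (subst sum.swap) (simp add: f_def pcompose_sum sum_divide_distrib)
  also have "(\<Sum>\<theta>\<in>UNIV - {0}. \<Sum>\<eta>\<in>UNIV. to_fract (G (- \<theta>) \<circ>\<^sub>p [:\<eta> + \<theta>, 1:]) / ?X (\<eta> + \<theta>) ^ a) =
      (\<Sum>\<theta>\<in>UNIV - {0}. \<Sum>\<eta>\<in>UNIV. to_fract (G (- \<theta>) \<circ>\<^sub>p [:\<eta>, 1:]) / ?X \<eta> ^ a)"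
  proof (rule sum.cong[OF refl])
    fix \<theta> :: 'a
    show "(\<Sum>\<eta>\<in>UNIV. to_fract (G (- \<theta>) \<circ>\<^sub>p [:\<eta> + \<theta>, 1:]) / ?X (\<eta> + \<theta>) ^ a) =
        (\<Sum>\<eta>\<in>UNIV. to_fract (G (- \<theta>) \<circ>\<^sub>p [:\<eta>, 1:]) / ?X \<eta> ^ a)"
      by (rule sum.reindex_bij_witness[of _ "\<lambda>\<eta>. \<eta> - \<theta>" "\<lambda>\<eta>. \<eta> + \<theta>"]) auto
  qed
  also have "\<dots> = (\<Sum>\<theta>\<in>UNIV - {0}. \<Sum>\<eta>\<in>UNIV. to_fract (G \<theta> \<circ>\<^sub>p [:\<eta>, 1:]) / ?X \<eta> ^ a)"
    by (rule sum.reindex_bij_witness[of _ uminus uminus]) auto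
  also have "\<dots> = (\<Sum>\<eta>\<in>UNIV. to_fract (g \<circ>\<^sub>p [:\<eta>, 1:]) / ?X \<eta> ^ a)"
    by (subst sum.swap) (simp add: g_def pcompose_sum sum_divide_distrib)
  finally show ?thesis
    using deg le_less_trans[OF le0 deg(1)] le_less_trans[OF le0 deg(2)]
    by (simp add: sum_pcompose_div_power f_def g_def degree_sum_less)
qed

section \<open>Frobenius identities for t+\<theta>\<close>

lemma CHAR_eq_of_CARD:
  assumes "prime p" "CARD('a::{finite, field}) = p ^ s"
  shows "CHAR('a) = p"
proof -
  have "(of_nat p :: 'a) ^ s = 0"
    using of_nat_CARD_eq_0[where ?'a = 'a] assms(2) by simp
  then have "of_nat p = (0 :: 'a)"
    using power_eq_0_iff by blast
  then have "CHAR('a) dvd p" by (simp add: of_nat_eq_0_iff_char_dvd)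
  then show ?thesis
    using assms(1) CHAR_not_1[where ?'a = 'a] by (metis One_nat_def prime_nat_iff)
qed

lemma var_power_minus_1_power:
  assumes "prime p" "CHAR('a::field) = p"
  shows "(var_t ^ n - 1 :: 'a poly) ^ (p ^ m) = var_t ^ (n * p ^ m) - 1"
proof -
  have "prime CHAR('a poly)" using assms by simp
  from freshmans_dream'[OF this, of "p ^ m" m "var_t ^ n" "- 1"]
    minus_one_power_prime_char_power[OF this, of m]
  show ?thesis using assms by (simp add: power_mult)
qed

text \<open>The q-th power map is an iterate of Frobenius, hence additive, and it fixes the
  constants.\<close>

lemma shifted_power_CARD:
  assumes "prime p" "CARD('a::{finite, field}) = p ^ s"
  shows "[:\<theta> :: 'a, 1:] ^ CARD('a) = var_t ^ CARD('a) + [:\<theta>:]"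
proof -
  have "prime CHAR('a poly)" "CARD('a) = CHAR('a poly) ^ s"
    using assms CHAR_eq_of_CARD[OF assms] by simp_all
  from freshmans_dream'[OF this, of var_t "[:\<theta>:]"] show ?thesis
    by (simp add: poly_const_pow power_CARD)
qed

lemma power_CARD_Suc: "x ^ CARD('a::{finite, field}) = x * x ^ (CARD('a) - 1)"
  using CARD_field_ge_2[where ?'a = 'a] by (subst power_Suc[symmetric]) simp

text \<open>\<open>u\<close> is ((t+\<theta>)^(q-1) - 1)/t, a polynomial because \<theta>^(q-1) = 1.
  The second identity follows by cancelling t in (t+\<theta>)^q - (t+\<theta>) = t^q - t.\<close>

lemma shifted_power_cofactor:
  assumes "prime p" "CARD('a::{finite, field}) = p ^ s" "\<theta> \<noteq> (0 :: 'a)"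
  obtains u where "[:\<theta>, 1:] ^ (CARD('a) - 1) - 1 = var_t * u"
    "[:\<theta>, 1:] * u = var_t ^ (CARD('a) - 1) - 1"
proof -
  \<comment> \<open>The point is written \<open>- 0\<close> to match the criterion for divisibility
    by \<open>[:c, 1:]\<close> at c = 0.\<close>
  have "poly ([:\<theta>, 1:] ^ (CARD('a) - 1) - 1) (- 0) = 0"
    using power_CARD_minus_1[OF assms(3)] by (simp add: poly_power)
  then obtain u where u: "[:\<theta>, 1:] ^ (CARD('a) - 1) - 1 = var_t * u"
    unfolding dvd_iff_poly_eq_0[symmetric] by (elim dvdE)
  have "var_t * ([:\<theta>, 1:] * u) = [:\<theta>, 1:] * ([:\<theta>, 1:] ^ (CARD('a) - 1) - 1)"
    unfolding u by (rule mult.left_commute)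
  also have "\<dots> = [:\<theta>, 1:] ^ CARD('a) - [:\<theta>, 1:]"
    by (simp only: power_CARD_Suc right_diff_distrib mult_1_right)
  also have "\<dots> = var_t ^ CARD('a) - var_t"
    unfolding shifted_power_CARD[OF assms(1,2), of \<theta>] by simp
  also have "\<dots> = var_t * (var_t ^ (CARD('a) - 1) - 1)"
    by (simp only: power_CARD_Suc right_diff_distrib mult_1_right)
  finally have "[:\<theta>, 1:] * u = var_t ^ (CARD('a) - 1) - 1"
    by (rule mult_left_cancel[THEN iffD1, rotated]) simp
  with u show ?thesis by (rule that)
qed

text \<open>With w = -t/\<theta>, one has t+\<theta> = -\<theta>(w-1). Its product with the
  geometric sum is -\<theta>(w^q - 1) = (t+\<theta>)^q; cancel t+\<theta> and remove the term i =
  0.\<close>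

lemma shifted_power_expansion:
  assumes "prime p" "CARD('a::{finite, field}) = p ^ s" "\<theta> \<noteq> (0 :: 'a)"
  shows "[:\<theta>, 1:] ^ (CARD('a) - 1) - 1 = (\<Sum>i = 1..CARD('a) - 1. smult (- 1 / \<theta>) var_t ^ i)"
proof -
  let ?w = "smult (- 1 / \<theta>) var_t"
  have lin: "[:\<theta>, 1:] = smult (- \<theta>) (?w - 1)"
    using assms(3) by (simp add: one_pCons)
  have pow: "?w ^ CARD('a) = smult (- 1 / \<theta>) (var_t ^ CARD('a))"
    by (simp only: smult_power power_CARD)
  have "[:\<theta>, 1:] * (\<Sum>i<CARD('a). ?w ^ i) = smult (- \<theta>) ((?w - 1) * (\<Sum>i<CARD('a). ?w ^ i))"
    by (subst lin) (rule mult_smult_left)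
  also have "(?w - 1) * (\<Sum>i<CARD('a). ?w ^ i) = ?w ^ CARD('a) - 1"
    by (rule power_diff_1_eq[symmetric])
  also have "smult (- \<theta>) \<dots> = [:\<theta>, 1:] ^ CARD('a)"
    unfolding pow shifted_power_CARD[OF assms(1,2), of \<theta>]
    using assms(3) by (simp add: smult_diff_right one_pCons)
  also have "\<dots> = [:\<theta>, 1:] * [:\<theta>, 1:] ^ (CARD('a) - 1)"
    by (rule power_CARD_Suc)
  finally have "[:\<theta>, 1:] ^ (CARD('a) - 1) = (\<Sum>i<CARD('a). ?w ^ i)"
    by (rule mult_left_cancel[THEN iffD1, rotated, symmetric]) simp
  also have "{..<CARD('a)} = insert 0 {1..CARD('a) - 1}"
    using CARD_field_ge_2[where ?'a = 'a] by auto
  finally show ?thesis by simp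
qed

section \<open>The explicit formula for H\<close>

lemma sum_shifted_power_expansion:
  assumes "prime p" "CARD('a::{finite, field}) = p ^ s"
  shows "(\<Sum>\<theta>\<in>UNIV - {0 :: 'a}. ([:\<theta>, 1:] ^ (CARD('a) - 1) - 1) ^ x) =
    - (\<Sum>k\<in>adm_tuples (CARD('a) - 1) x. of_nat (multinomial x {1..CARD('a) - 1} k) *
        var_t ^ sigma_tuple (CARD('a) - 1) k)"
proof -
  let ?r = "CARD('a) - 1"
  let ?T = "{k \<in> {1..?r} \<rightarrow>\<^sub>E UNIV. (\<Sum>i = 1..?r. k i) = x}"
  let ?m = "\<lambda>k. of_nat (multinomial x {1..?r} k) :: 'a poly"
  have fin: "finite ?T"
    by (rule finite_PiE_sum_eq) simp
  have "([:\<theta>, 1:] ^ ?r - 1) ^ x =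
      (\<Sum>k\<in>?T. ?m k * smult ((- 1 / \<theta>) ^ sigma_tuple ?r k) (var_t ^ sigma_tuple ?r k))"
    if "\<theta> \<noteq> 0" for \<theta> :: 'a
  proof -
    have "(\<Prod>i = 1..?r. (smult (- 1 / \<theta>) var_t ^ i) ^ k i) = smult (- 1 / \<theta>) var_t ^ sigma_tuple ?r k" for k
      by (simp only: sigma_tuple_def power_mult[symmetric] power_sum[symmetric])
    then have "(\<Prod>i = 1..?r. (smult (- 1 / \<theta>) var_t ^ i) ^ k i) =
        smult ((- 1 / \<theta>) ^ sigma_tuple ?r k) (var_t ^ sigma_tuple ?r k)" for k
      by (simp only: smult_power)
    then show ?thesis
      unfolding shifted_power_expansion[OF assms that]
      by (simp only: multinomial_theorem[OF finite_atLeastAtMost])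
  qed
  then have "(\<Sum>\<theta>\<in>UNIV - {0 :: 'a}. ([:\<theta>, 1:] ^ ?r - 1) ^ x) =
      (\<Sum>\<theta>\<in>UNIV - {0}. \<Sum>k\<in>?T. ?m k * smult ((- 1 / \<theta>) ^ sigma_tuple ?r k) (var_t ^ sigma_tuple ?r k))"
    by (intro sum.cong) auto
  also have "\<dots> = (\<Sum>k\<in>?T. \<Sum>\<theta>\<in>UNIV - {0}. ?m k * smult ((- 1 / \<theta>) ^ sigma_tuple ?r k) (var_t ^ sigma_tuple ?r k))"
    by (rule sum.swap)
  also have "\<dots> = (\<Sum>k\<in>?T. if ?r dvd sigma_tuple ?r k then - (?m k * var_t ^ sigma_tuple ?r k) else 0)"
  proof (rule sum.cong[OF refl])
    fix k
    let ?n = "sigma_tuple ?r k"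
    \<comment> \<open>The involution sending \<theta> to -1/\<theta> turns this into the plain power
      sum.\<close>
    have "(\<Sum>\<theta>\<in>UNIV - {0 :: 'a}. (- 1 / \<theta>) ^ ?n) = (\<Sum>\<theta>\<in>UNIV - {0}. \<theta> ^ ?n)"
      by (rule sum.reindex_bij_witness[of _ "\<lambda>\<theta>. - 1 / \<theta>" "\<lambda>\<theta>. - 1 / \<theta>"]) auto
    then have "(\<Sum>\<theta>\<in>UNIV - {0 :: 'a}. (- 1 / \<theta>) ^ ?n) = (if ?r dvd ?n then - 1 else 0)"
      by (simp only: sum_power_nonzero)
    moreover have "(\<Sum>\<theta>\<in>UNIV - {0}. ?m k * smult ((- 1 / \<theta>) ^ ?n) (var_t ^ ?n)) =
        ?m k * smult (\<Sum>\<theta>\<in>UNIV - {0}. (- 1 / \<theta>) ^ ?n) (var_t ^ ?n)"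
      by (simp only: sum_distrib_left[symmetric] smult_sum)
    ultimately show "(\<Sum>\<theta>\<in>UNIV - {0}. ?m k * smult ((- 1 / \<theta>) ^ ?n) (var_t ^ ?n)) =
        (if ?r dvd ?n then - (?m k * var_t ^ ?n) else 0)"
      by simp
  qed
  also have "\<dots> = (\<Sum>k\<in>{k \<in> ?T. ?r dvd sigma_tuple ?r k}. - (?m k * var_t ^ sigma_tuple ?r k))"
    by (rule sum.inter_filter[OF fin, symmetric])
  also have "{k \<in> ?T. ?r dvd sigma_tuple ?r k} = adm_tuples ?r x"
    by (auto simp: adm_tuples_def)
  finally show ?thesis by (simp only: sum_negf)
qed

text \<open>An identity of polynomials, before any truncation. The minus sign in front of
  \<open>R_rhs\<close> cancels the one from the power sums over \<theta>; the remaining signs come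
  from the binomial theorem.\<close>

lemma R_rhs_expansion:
  assumes "prime p" "CARD('a::{finite, field}) = p ^ s" "x \<le> p ^ m"
  shows "(R_rhs p m x :: 'a poly) =
    (\<Sum>j = 0..p ^ m - x. \<Sum>k\<in>adm_tuples (CARD('a) - 1) x.
      of_nat ((p ^ m - x) choose j) * of_nat (multinomial x {1..CARD('a) - 1} k) *
      (- 1) ^ (x + j + 1) * var_t ^ (j * (CARD('a) - 1) + sigma_tuple (CARD('a) - 1) k))"
proof -
  let ?r = "CARD('a) - 1" and ?M = "p ^ m - x"
  let ?S = "\<Sum>k\<in>adm_tuples ?r x. of_nat (multinomial x {1..?r} k) * var_t ^ sigma_tuple ?r k :: 'a poly"
  have "prime CHAR('a poly)" "CHAR('a poly) = p"
    using assms CHAR_eq_of_CARD[OF assms(1,2)] by simp_all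
  note neg = minus_one_power_prime_char_power[OF this(1), of m, unfolded this(2)]
  \<comment> \<open>Since (-1)^(p^m) = -1, the exponent p^m-x-j can be traded for x+j+1.\<close>
  have sgn: "(- 1 :: 'a poly) ^ (?M - j) = (- 1) ^ (x + j + 1)" if "j \<le> ?M" for j
  proof -
    have "(- 1 :: 'a poly) ^ k = (- 1) ^ (k + n) * (- 1) ^ n" for k n
      by (simp add: power_add mult.assoc)
    then have "(- 1 :: 'a poly) ^ (?M - j) = (- 1) ^ (?M - j + (x + j)) * (- 1) ^ (x + j)" .
    also have "?M - j + (x + j) = p ^ m" using that assms(3) by simp
    finally show ?thesis by (simp add: neg)
  qed
  have "(var_t ^ ?r - 1 :: 'a poly) ^ ?M = (\<Sum>j\<le>?M. of_nat (?M choose j) * (var_t ^ ?r) ^ j * (- 1) ^ (?M - j))"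
    by (subst diff_conv_add_uminus) (rule binomial_ring)
  also have "\<dots> = (\<Sum>j = 0..?M. of_nat (?M choose j) * var_t ^ (j * ?r) * (- 1) ^ (x + j + 1))"
  proof (rule sum.cong)
    fix j assume "j \<in> {0..?M}"
    then have "j \<le> ?M" by simp
    then show "of_nat (?M choose j) * (var_t ^ ?r) ^ j * (- 1 :: 'a poly) ^ (?M - j) =
        of_nat (?M choose j) * var_t ^ (j * ?r) * (- 1) ^ (x + j + 1)"
      by (simp only: sgn power_mult[symmetric] mult.commute[of ?r])
  qed auto
  finally have binom: "(var_t ^ ?r - 1 :: 'a poly) ^ ?M = \<dots>" .
  have shift: "var_t + [:\<theta>:] = [:\<theta>, 1:]" for \<theta> :: 'a by simp
  have "(R_rhs p m x :: 'a poly) = (var_t ^ ?r - 1) ^ ?M * ?S"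
    unfolding R_rhs_def shift sum_shifted_power_expansion[OF assms(1,2)] by simp
  also have "\<dots> = (\<Sum>j = 0..?M. \<Sum>k\<in>adm_tuples ?r x.
      (of_nat (?M choose j) * var_t ^ (j * ?r) * (- 1) ^ (x + j + 1)) *
      (of_nat (multinomial x {1..?r} k) * var_t ^ sigma_tuple ?r k))"
    unfolding binom by (rule sum_product)
  finally show ?thesis by (simp only: power_add mult_ac)
qed

lemma R_poly_eqI:
  assumes "degree R < x + y" "[R = R_rhs p m x] (mod var_t ^ (x + y))"
  shows "R_poly p m x y = R"
  unfolding R_poly_def
  by (rule the1_equality[OF ex1_R_poly]) (use assms in auto)

text \<open>Terms of exponent at least x+y vanish modulo t^(x+y). The rest has degree below x+y, so
  by uniqueness it is \<open>R_poly\<close>.\<close>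

lemma H_frac_expansion:
  assumes "prime p" "CARD('a::{finite, field}) = p ^ s" "x + y > 0" "x + y \<le> p ^ m"
  shows "(H_frac p m x y :: 'a poly fract) =
    (\<Sum>j = 0..p ^ m - x. \<Sum>k\<in>{k \<in> adm_tuples (CARD('a) - 1) x.
        j * (CARD('a) - 1) + sigma_tuple (CARD('a) - 1) k < x + y}.
      of_nat ((p ^ m - x) choose j) * of_nat (multinomial x {1..CARD('a) - 1} k) *
      (- 1) ^ (x + j + 1) *
      to_fract var_t powi (int (j * (CARD('a) - 1) + sigma_tuple (CARD('a) - 1) k) - int x))"
proof -
  let ?r = "CARD('a) - 1" and ?M = "p ^ m - x"
  let ?e = "\<lambda>j k. j * ?r + sigma_tuple ?r k"
  let ?A = "adm_tuples ?r x"
  let ?c = "\<lambda>j k. of_nat (?M choose j) * of_nat (multinomial x {1..?r} k) * (- 1) ^ (x + j + 1) :: 'a poly"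
  define R :: "'a poly" where "R = (\<Sum>j = 0..?M. \<Sum>k\<in>{k \<in> ?A. ?e j k < x + y}. ?c j k * var_t ^ ?e j k)"
  \<comment> \<open>The coefficients are constant polynomials, so the degree of a term is at most
    its exponent of t.\<close>
  have c: "\<exists>a. ?c j k = [:a:]" for j k
  proof -
    have "(- 1 :: 'a poly) ^ n = [:(- 1) ^ n:]" for n
      using poly_const_pow[of "- 1 :: 'a" n] by (simp add: one_pCons)
    then show ?thesis by (simp add: of_nat_poly del: power_Suc)
  qed
  have "degree (?c j k * var_t ^ ?e j k) \<le> ?e j k" for j k
  proof -
    obtain a where "?c j k = [:a:]" using c by blast
    moreover have "degree ([:a:] * var_t ^ ?e j k) \<le> 0 + degree (var_t ^ ?e j k :: 'a poly)"
      using degree_mult_le[of "[:a:]"] by (simp only: degree_pCons_0)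
    ultimately show ?thesis by (simp add: degree_power_eq)
  qed
  then have deg: "degree R < x + y"
    unfolding R_def using assms(3) by (intro degree_sum_less) (auto intro: le_less_trans)
  have "R_rhs p m x - R = (\<Sum>j = 0..?M. \<Sum>k\<in>?A - {k \<in> ?A. ?e j k < x + y}. ?c j k * var_t ^ ?e j k)"
    unfolding R_rhs_expansion[OF assms(1,2) order_trans[OF le_add1 assms(4)]] R_def sum_subtractf[symmetric]
    by (intro sum.cong refl sum_diff[symmetric] finite_adm_tuples) auto
  also have "var_t ^ (x + y) dvd \<dots>"
    by (intro dvd_sum dvd_mult le_imp_power_dvd) auto
  finally have "[R = R_rhs p m x] (mod var_t ^ (x + y))"
    by (subst cong_sym_eq) (simp add: cong_iff_dvd_diff)
  then have "(R_poly p m x y :: 'a poly) = R" using deg by (intro R_poly_eqI)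
  then have "(H_frac p m x y :: 'a poly fract) = to_fract var_t powi (- int x) * to_fract R"
    by (simp add: H_frac_def)
  also have "\<dots> = (\<Sum>j = 0..?M. \<Sum>k\<in>{k \<in> ?A. ?e j k < x + y}.
      to_fract (?c j k) * to_fract var_t powi (int (?e j k) - int x))"
  proof -
    have "to_fract var_t powi (int n - int x) = to_fract var_t powi (- int x) * to_fract (var_t :: 'a poly) ^ n" for n
      using power_int_add[of "to_fract (var_t :: 'a poly)" "- int x" "int n"] by simp
    then show ?thesis
      unfolding R_def to_fract_sum sum_distrib_left
      by (intro sum.cong refl) (simp only: to_fract_mult to_fract_power mult_ac)
  qed
  also have "\<dots> = (\<Sum>j = 0..?M. \<Sum>k\<in>{k \<in> ?A. ?e j k < x + y}.
      of_nat (?M choose j) * of_nat (multinomial x {1..?r} k) * (- 1) ^ (x + j + 1) *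
      to_fract var_t powi (int (?e j k) - int x))"
  proof -
    have "to_fract (of_nat n :: 'a poly) = of_nat n" for n
      by (induction n) simp_all
    then show ?thesis by (simp only: to_fract_mult to_fract_power to_fract_uminus to_fract_1)
  qed
  finally show ?thesis .
qed

section \<open>H as a sum of truncated inverses\<close>

text \<open>With v = t^(q-1) - 1 and u the cofactor above, C = -v^(p^m - x) u^x satisfies C
  (t+\<theta>)^x = -v^(p^m), which is 1 up to a high power of t. The x factors t in (t u)^x give the
  t^x in front of the sum.\<close>

lemma shifted_power_inverses:
  assumes "prime p" "CARD('a::{finite, field}) = p ^ s" "x + y > 0" "x + y \<le> p ^ m"
  obtains C :: "'a::{finite, field} \<Rightarrow> 'a poly"
  where "\<And>\<theta>. \<theta> \<noteq> 0 \<Longrightarrow> [C \<theta> * [:\<theta>, 1:] ^ x = 1] (mod var_t ^ (x + y))"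
    "R_rhs p m x = var_t ^ x * (\<Sum>\<theta>\<in>UNIV - {0}. C \<theta>)"
proof -
  let ?r = "CARD('a) - 1"
  have "\<exists>u. [:\<theta>, 1:] ^ ?r - 1 = var_t * u \<and> [:\<theta>, 1:] * u = var_t ^ ?r - 1" if "\<theta> \<noteq> 0" for \<theta> :: 'a
    using shifted_power_cofactor[OF assms(1,2) that] by blast
  then obtain u :: "'a \<Rightarrow> 'a poly" where
    u: "\<And>\<theta>. \<theta> \<noteq> 0 \<Longrightarrow> [:\<theta>, 1:] ^ ?r - 1 = var_t * u \<theta>"
       "\<And>\<theta>. \<theta> \<noteq> 0 \<Longrightarrow> [:\<theta>, 1:] * u \<theta> = var_t ^ ?r - 1"
    by metis
  define v :: "'a poly" where "v = var_t ^ ?r - 1"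
  define C where "C \<theta> = - (v ^ (p ^ m - x) * u \<theta> ^ x)" for \<theta>
  show thesis
  proof (rule that)
    fix \<theta> :: 'a assume \<theta>: "\<theta> \<noteq> 0"
    have "C \<theta> * [:\<theta>, 1:] ^ x = - (v ^ (p ^ m - x) * ([:\<theta>, 1:] * u \<theta>) ^ x)"
      by (simp add: C_def power_mult_distrib mult_ac del: mult_pCons_left mult_pCons_right)
    also have "[:\<theta>, 1:] * u \<theta> = v" using u(2)[OF \<theta>] by (simp only: v_def)
    also have "v ^ (p ^ m - x) * v ^ x = v ^ p ^ m"
      using assms(4) by (simp flip: power_add)
    also have "v ^ p ^ m = var_t ^ (?r * p ^ m) - 1"
      unfolding v_def by (rule var_power_minus_1_power[OF assms(1) CHAR_eq_of_CARD[OF assms(1,2)]])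
    finally have "C \<theta> * [:\<theta>, 1:] ^ x - 1 = - (var_t ^ (?r * p ^ m))" by simp
    \<comment> \<open>As q \<ge> 2, the exponent of the error term is at least p^m.\<close>
    moreover have "x + y \<le> ?r * p ^ m"
      using assms(4) CARD_field_ge_2[where ?'a = 'a] mult_le_mono1[of 1 ?r "p ^ m"] by linarith
    ultimately show "[C \<theta> * [:\<theta>, 1:] ^ x = 1] (mod var_t ^ (x + y))"
      by (simp add: cong_iff_dvd_diff le_imp_power_dvd)
  next
    have shift: "var_t + [:\<theta>:] = [:\<theta>, 1:]" for \<theta> :: 'a by simp
    have "(\<Sum>\<theta>\<in>UNIV - {0 :: 'a}. ([:\<theta>, 1:] ^ ?r - 1) ^ x) = (\<Sum>\<theta>\<in>UNIV - {0}. (var_t * u \<theta>) ^ x)"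
      by (intro sum.cong arg_cong[where f = "\<lambda>z. z ^ x"] u(1)) auto
    then have "R_rhs p m x = - (v ^ (p ^ m - x) * (\<Sum>\<theta>\<in>UNIV - {0}. (var_t * u \<theta>) ^ x))"
      by (simp only: R_rhs_def shift v_def)
    also have "\<dots> = var_t ^ x * (\<Sum>\<theta>\<in>UNIV - {0}. C \<theta>)"
      by (simp add: C_def power_mult_distrib sum_distrib_left sum_negf mult_ac del: mult_pCons_left mult_pCons_right)
    finally show "R_rhs p m x = var_t ^ x * (\<Sum>\<theta>\<in>UNIV - {0}. C \<theta>)" .
  qed
qed

text \<open>\<open>F\<close> is \<open>C\<close> reduced modulo t^y. Multiplying by t^x raises the
  precision from y to x+y, which identifies t^x times the sum of the \<open>F \<theta>\<close> with
  \<open>R_poly\<close>; the factor t^(-x) then cancels, so H is a polynomial.\<close>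

lemma H_frac_eq_sum_inverses:
  assumes "prime p" "CARD('a::{finite, field}) = p ^ s" "y > 0" "x + y \<le> p ^ m"
  obtains F :: "'a::{finite, field} \<Rightarrow> 'a poly"
  where "\<And>\<theta>. degree (F \<theta>) < y"
    "\<And>\<theta>. \<theta> \<noteq> 0 \<Longrightarrow> [F \<theta> * [:\<theta>, 1:] ^ x = 1] (mod var_t ^ y)"
    "H_frac p m x y = to_fract (\<Sum>\<theta>\<in>UNIV - {0}. F \<theta>)"
proof -
  obtain C :: "'a \<Rightarrow> 'a poly" where
    C: "\<And>\<theta>. \<theta> \<noteq> 0 \<Longrightarrow> [C \<theta> * [:\<theta>, 1:] ^ x = 1] (mod var_t ^ (x + y))"
      "R_rhs p m x = var_t ^ x * (\<Sum>\<theta>\<in>UNIV - {0}. C \<theta>)"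
    by (rule shifted_power_inverses[OF assms(1,2) _ assms(4)]) (use assms(3) that in \<open>auto\<close>)
  define F where "F \<theta> = C \<theta> mod var_t ^ y" for \<theta>
  let ?f = "\<Sum>\<theta>\<in>UNIV - {0}. F \<theta>"
  have deg: "degree (F \<theta>) < y" for \<theta>
    using degree_mod_less[of "var_t ^ y" "C \<theta>"] assms(3) by (auto simp: F_def degree_power_eq)
  have FC: "[F \<theta> = C \<theta>] (mod var_t ^ y)" for \<theta>
    by (simp add: F_def cong_def)
  have "degree (var_t ^ x * ?f) < x + y"
  proof -
    have "degree ?f < y" using deg assms(3) by (intro degree_sum_less) auto
    then show ?thesis
      using degree_mult_le[of "var_t ^ x" ?f] by (simp add: degree_power_eq)
  qed
  moreover have "[var_t ^ x * ?f = R_rhs p m x] (mod var_t ^ (x + y))"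
  proof -
    have "[?f = (\<Sum>\<theta>\<in>UNIV - {0}. C \<theta>)] (mod var_t ^ y)"
      by (intro cong_sum FC)
    then show ?thesis
      by (simp add: C(2) cong_iff_dvd_diff power_add mult_dvd_mono flip: right_diff_distrib)
  qed
  ultimately have "R_poly p m x y = var_t ^ x * ?f" by (rule R_poly_eqI)
  then have H: "H_frac p m x y = to_fract ?f"
    by (simp add: H_frac_def power_int_minus to_fract_power)
  have inv: "[F \<theta> * [:\<theta>, 1:] ^ x = 1] (mod var_t ^ y)" if "\<theta> \<noteq> 0" for \<theta>
  proof -
    have "[C \<theta> * [:\<theta>, 1:] ^ x = 1] (mod var_t ^ y)"
      using C(1)[OF that] by (rule cong_dvd_modulus) (simp add: power_add)
    then show ?thesis
      by (rule cong_trans[OF cong_scalar_right[OF FC]])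
  qed
  show thesis by (rule that[OF deg inv H])
qed

theorem theorem7p1:
  fixes p s m a b :: nat
  assumes "prime p"
    and "CARD('a::{finite, field}) = p ^ s"
    and "a > 0" and "b > 0"
    and "m = (LEAST m. a + b \<le> p ^ m)"
  shows "(\<exists>f g :: 'a poly.
            to_fract f = H_frac p m a b \<and> degree f < b \<and>
            to_fract g = H_frac p m b a \<and> degree g < a \<and>
            (Delta a b :: 'a poly fract) =
              (\<Sum>i = 0..b - 1. to_fract [:coeff f i:] * S1 (int b - int i)) +
              (\<Sum>j = 0..a - 1. to_fract [:coeff g j:] * S1 (int a - int j)))
       \<and> (\<forall>(x, y) \<in> {(a, b), (b, a)}.
            (H_frac p m x y :: 'a poly fract) =
              (\<Sum>j = 0..p ^ m - x.
                 \<Sum>k \<in> {k \<in> adm_tuples (CARD('a) - 1) x.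
                          j * (CARD('a) - 1) + sigma_tuple (CARD('a) - 1) k < a + b}.
                   of_nat ((p ^ m - x) choose j)
                   * of_nat (multinomial x {1..CARD('a) - 1} k)
                   * (- 1) ^ (x + j + 1)
                   * to_fract var_t powi
                       (int (j * (CARD('a) - 1) + sigma_tuple (CARD('a) - 1) k) - int x)))"
proof (rule conjI)
  \<comment> \<open>The exponent a+b shows that some power of p is large enough, so the
    \<open>LEAST\<close> exponent satisfies its defining inequality.\<close>
  have "a + b < p ^ (a + b)"
    using assms(1) by (intro power_gt_expt) (rule prime_gt_Suc_0_nat)
  then have le: "a + b \<le> p ^ m"
    unfolding assms(5) by (intro LeastI[of "\<lambda>m. a + b \<le> p ^ m"]) (rule less_imp_le)
  then have le': "b + a \<le> p ^ m" by (simp only: add.commute)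
  obtain F :: "'a \<Rightarrow> 'a poly" where F: "\<And>\<theta>. degree (F \<theta>) < b"
      "\<And>\<theta>. \<theta> \<noteq> 0 \<Longrightarrow> [F \<theta> * [:\<theta>, 1:] ^ a = 1] (mod var_t ^ b)"
      "H_frac p m a b = to_fract (\<Sum>\<theta>\<in>UNIV - {0}. F \<theta>)"
    by (rule H_frac_eq_sum_inverses[OF assms(1,2,4) le]) (blast intro: that)
  obtain G :: "'a \<Rightarrow> 'a poly" where G: "\<And>\<theta>. degree (G \<theta>) < a"
      "\<And>\<theta>. \<theta> \<noteq> 0 \<Longrightarrow> [G \<theta> * [:\<theta>, 1:] ^ b = 1] (mod var_t ^ a)"
      "H_frac p m b a = to_fract (\<Sum>\<theta>\<in>UNIV - {0}. G \<theta>)"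
    by (rule H_frac_eq_sum_inverses[OF assms(1,2,3) le']) (blast intro: that)
  \<comment> \<open>Positivity matters: by truncated subtraction, \<open>{0..n - 1}\<close> contains
    0 even for n = 0.\<close>
  have "{0..n - 1} = {..<n}" if "n > 0" for n :: nat
    using that by auto
  note ivl = this[OF assms(3)] this[OF assms(4)]
  have deg: "degree (\<Sum>\<theta>\<in>UNIV - {0}. F \<theta>) < b" "degree (\<Sum>\<theta>\<in>UNIV - {0}. G \<theta>) < a"
    using F(1) G(1) assms(3,4) by (auto intro: degree_sum_less)
  show "\<exists>f g :: 'a poly.
            to_fract f = H_frac p m a b \<and> degree f < b \<and>
            to_fract g = H_frac p m b a \<and> degree g < a \<and>
            (Delta a b :: 'a poly fract) =
              (\<Sum>i = 0..b - 1. to_fract [:coeff f i:] * S1 (int b - int i)) +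
              (\<Sum>j = 0..a - 1. to_fract [:coeff g j:] * S1 (int a - int j))"
    unfolding ivl
    by (intro exI conjI, rule F(3)[symmetric], rule deg, rule G(3)[symmetric], rule deg,
        rule Delta_partial_fractions[OF F(1) G(1) F(2) G(2)])
  show "\<forall>(x, y) \<in> {(a, b), (b, a)}.
            (H_frac p m x y :: 'a poly fract) =
              (\<Sum>j = 0..p ^ m - x.
                 \<Sum>k \<in> {k \<in> adm_tuples (CARD('a) - 1) x.
                          j * (CARD('a) - 1) + sigma_tuple (CARD('a) - 1) k < a + b}.
                   of_nat ((p ^ m - x) choose j)
                   * of_nat (multinomial x {1..CARD('a) - 1} k)
                   * (- 1) ^ (x + j + 1)
                   * to_fract var_t powi
                       (int (j * (CARD('a) - 1) + sigma_tuple (CARD('a) - 1) k) - int x))"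
    using H_frac_expansion[OF assms(1,2) _ le] H_frac_expansion[OF assms(1,2) _ le'] assms(3)
    unfolding add.commute[of b a] by simp
qed

end
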